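(* Let $\lambda>0$ and $\alpha\in\mathbb{R}$, and let $(\mathbb{R}^2,g_{\rm can},\mathcal{W}_{\lambda,\alpha})$ be the conductive Riemannian manifold in which $g_{\rm can}$ is the Euclidean metric and the conductivity $\mathcal{W}_{\lambda,\alpha}$ is the $(1,1)$-tensor field given at each $(x,y)\in\mathbb{R}^2$ by $$\mathcal{W}_{\lambda,\alpha}(\partial_x)=e^{\alpha(x^2+y^2)}\big((\lambda+1)\partial_x+(\lambda-1)\partial_y\big),\qquad \mathcal{W}_{\lambda,\alpha}(\partial_y)=e^{\alpha(x^2+y^2)}\big((\lambda-1)\partial_x+(\lambda+1)\partial_y\big).$$ Then, for any choice of $\lambda>0$, $(\mathbb{R}^2,g_{\rm can},\mathcal{W}_{\lambda,\alpha})$ is $\mathcal{W}_{\lambda,\alpha}$-parabolic if $\alpha\le 0$ and $\mathcal{W}_{\lambda,\alpha}$-hyperbolic if $\alpha>0$.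
   Context: A conductive Riemannian manifold $(M,g,\mathcal{W})$ is a complete (connected) Riemannian manifold $(M,g)$ together with a smooth $(1,1)$-tensor field $\mathcal{W}$ (the conductivity) that is self-adjoint and positive definite with respect to $g$ at every point. The $\mathcal{W}$-Laplacian of $u\in C^\infty(M)$ is $\Delta_{\mathcal{W}}u=\operatorname{div}(\mathcal{W}(\nabla u))$. A smooth function $u$ is $\mathcal{W}$-subharmonic if $\Delta_{\mathcal{W}}u\ge 0$. $(M,g,\mathcal{W})$ is $\mathcal{W}$-parabolic if every $\mathcal{W}$-subharmonic function on $M$ that is bounded from above is constant; otherwise it is $\mathcal{W}$-hyperbolic. *)

theory Defs
  imports "HOL-Analysis.Analysis"
begin

text \<open>
  Conductive structures are set up on a Euclidean space with its canonical metric (the inner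
  product \<open>\<bullet>\<close>), a complete and connected Riemannian manifold. Every tangent space is
  identified with the space itself, so a vector field is a map \<open>'a \<Rightarrow> 'a\<close>
  and a (1,1)-tensor field is a map \<open>W\<close> for which each \<open>W x\<close> is a linear
  endomorphism.
\<close>

primrec Ck :: "nat \<Rightarrow> ('a::euclidean_space \<Rightarrow> 'b::real_normed_vector) \<Rightarrow> bool" where
  "Ck 0 f \<longleftrightarrow> continuous_on UNIV f"
| "Ck (Suc k) f \<longleftrightarrow>
     (\<forall>x. f differentiable (at x)) \<and> (\<forall>v. Ck k (\<lambda>x. frechet_derivative f (at x) v))"

definition smooth :: "('a::euclidean_space \<Rightarrow> 'b::real_normed_vector) \<Rightarrow> bool" where
  "smooth f \<longleftrightarrow> (\<forall>k. Ck k f)"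

definition conductivity :: "('a::euclidean_space \<Rightarrow> 'a \<Rightarrow> 'a) \<Rightarrow> bool" where
  "conductivity W \<longleftrightarrow>
     (\<forall>x. linear (W x)) \<and>
     (\<forall>v. smooth (\<lambda>x. W x v)) \<and>
     (\<forall>x v w. W x v \<bullet> w = v \<bullet> W x w) \<and>
     (\<forall>x v. v \<noteq> 0 \<longrightarrow> 0 < W x v \<bullet> v)"

definition grad :: "('a::euclidean_space \<Rightarrow> real) \<Rightarrow> 'a \<Rightarrow> 'a" where
  "grad u x = (THE D. GDERIV u x :> D)"

text \<open>For the Euclidean metric the divergence is the trace of the derivative.\<close>

definition divergence :: "('a::euclidean_space \<Rightarrow> 'a) \<Rightarrow> 'a \<Rightarrow> real" where
  "divergence X x = (\<Sum>b\<in>Basis. frechet_derivative X (at x) b \<bullet> b)"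

definition W_laplacian ::
    "('a::euclidean_space \<Rightarrow> 'a \<Rightarrow> 'a) \<Rightarrow> ('a \<Rightarrow> real) \<Rightarrow> 'a \<Rightarrow> real" where
  "W_laplacian W u = divergence (\<lambda>x. W x (grad u x))"

definition W_subharmonic ::
    "('a::euclidean_space \<Rightarrow> 'a \<Rightarrow> 'a) \<Rightarrow> ('a \<Rightarrow> real) \<Rightarrow> bool" where
  "W_subharmonic W u \<longleftrightarrow> smooth u \<and> (\<forall>x. W_laplacian W u x \<ge> 0)"

definition W_parabolic :: "('a::euclidean_space \<Rightarrow> 'a \<Rightarrow> 'a) \<Rightarrow> bool" where
  "W_parabolic W \<longleftrightarrow>
     (\<forall>u. W_subharmonic W u \<longrightarrow> bdd_above (range u) \<longrightarrow> u constant_on UNIV)"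

definition W_hyperbolic :: "('a::euclidean_space \<Rightarrow> 'a \<Rightarrow> 'a) \<Rightarrow> bool" where
  "W_hyperbolic W \<longleftrightarrow> \<not> W_parabolic W"

definition dx :: "real^2" where "dx = axis 1 1"

definition dy :: "real^2" where "dy = axis 2 1"

text \<open>The linear extension of the prescribed values on the coordinate fields \<open>dx\<close>, \<open>dy\<close>.\<close>

definition W_field :: "real \<Rightarrow> real \<Rightarrow> real^2 \<Rightarrow> real^2 \<Rightarrow> real^2" where
  "W_field lam \<alpha> p v =
     (v $ 1) *\<^sub>R (exp (\<alpha> * ((p $ 1)\<^sup>2 + (p $ 2)\<^sup>2)) *\<^sub>R ((lam + 1) *\<^sub>R dx + (lam - 1) *\<^sub>R dy)) +
     (v $ 2) *\<^sub>R (exp (\<alpha> * ((p $ 1)\<^sup>2 + (p $ 2)\<^sup>2)) *\<^sub>R ((lam - 1) *\<^sub>R dx + (lam + 1) *\<^sub>R dy))"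

lemma W_field_dx:
  "W_field lam \<alpha> p dx =
     exp (\<alpha> * ((p $ 1)\<^sup>2 + (p $ 2)\<^sup>2)) *\<^sub>R ((lam + 1) *\<^sub>R dx + (lam - 1) *\<^sub>R dy)"
  by (simp add: W_field_def dx_def axis_def)

lemma W_field_dy:
  "W_field lam \<alpha> p dy =
     exp (\<alpha> * ((p $ 1)\<^sup>2 + (p $ 2)\<^sup>2)) *\<^sub>R ((lam - 1) *\<^sub>R dx + (lam + 1) *\<^sub>R dy)"
  by (simp add: W_field_def dy_def axis_def)

end

theory Submission imports Defs begin

text \<open>
  The conductivity is \<open>exp (\<alpha> * (p \<bullet> p))\<close> times a constant symmetric matrix \<open>A\<close> with the
  orthogonal eigenvectors \<open>diag = (1, 1)\<close> (eigenvalue \<open>2 * lam\<close>) and \<open>antidiag = (1, -1)\<close>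
  (eigenvalue \<open>2\<close>). This gives the conductivity axioms at once, and up to the positive exponential
  factor the Laplacian becomes
  \<open>L u = tr (A D\<^sup>2u) + 2 * \<alpha> * (p \<bullet> A \<nabla>u)\<close>, a constant-coefficient elliptic operator plus the
  drift along the linear field \<open>2 * \<alpha> * A p\<close> (\<open>W_laplacian_frame\<close>).

  For \<open>\<alpha> > 0\<close> the drift points outwards, and the bounded function
  \<open>u = - exp (- \<alpha> * (p \<bullet> p))\<close> is a witness of hyperbolicity: the exponentials cancel in its
  flux, which is the linear field \<open>2 * \<alpha> * A p\<close> with constant positive divergence.

  For \<open>\<alpha> \<le> 0\<close> the drift points inwards, and the logarithm of \<open>s\<close>, a multiple of the
  quadratic form of \<open>A\<^sup>-\<^sup>1\<close> centred at a point \<open>p0\<close>, is \<open>tr (A D\<^sup>2)\<close>-harmonic and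
  tends to infinity. If \<open>p0\<close> is the origin it is \<open>L\<close>-superharmonic. For other \<open>p0\<close> the drift has the
  wrong sign in a bounded region, and subtracting \<open>S ^ k / s ^ k\<close> with \<open>k\<close> and \<open>S\<close> large
  repairs this: the resulting \<open>h\<close> satisfies \<open>L h < 0\<close> on the whole punctured plane
  (\<open>barrier_profile\<close> contains the calculus). Given \<open>u p1 > u p0\<close>
  for a subharmonic \<open>u\<close> bounded above, the function \<open>u - \<epsilon> * h\<close>, for small
  \<open>\<epsilon> > 0\<close>, has a local maximum away from \<open>p0\<close> (\<open>exterior_comparison\<close>), and there
  \<open>0 \<le> L u \<le> \<epsilon> * L h < 0\<close> by the second derivative test (\<open>line_test\<close>). So
  \<open>u p1 \<le> u p0\<close> for all \<open>p0\<close> and \<open>p1\<close>. Since the pole of the barrier can be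
  placed at any point, exchanging \<open>p0\<close> and \<open>p1\<close> shows that \<open>u\<close> is constant.
\<close>

section \<open>Smooth functions\<close>

lemma Ck_SucI:
  assumes "\<And>x. (f has_derivative f' x) (at x)" and "\<And>v. Ck k (\<lambda>x. f' x v)"
  shows "Ck (Suc k) f"
proof -
  have "frechet_derivative f (at x) = f' x" for x
    using assms(1) frechet_derivative_at by metis
  then show ?thesis using assms by (auto simp: differentiable_def)
qed

lemma Ck_Suc_has_derivative:
  "Ck (Suc k) f \<Longrightarrow> (f has_derivative frechet_derivative f (at x)) (at x)"
  by (simp add: frechet_derivative_works)

lemma Ck_SucD: "Ck (Suc k) f \<Longrightarrow> Ck k f"
proof (induction k arbitrary: f)
  case 0
  then show ?case
    by (auto intro!: differentiable_imp_continuous_on simp: differentiable_on_def)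
qed auto

lemma Ck_const: "Ck k (\<lambda>x. c)"
proof (induction k arbitrary: c)
  case (Suc k)
  show ?case by (rule Ck_SucI[where f' = "\<lambda>x v. 0"]) (auto intro: Suc)
qed auto

lemma Ck_add: "Ck k f \<Longrightarrow> Ck k g \<Longrightarrow> Ck k (\<lambda>x. f x + g x)"
proof (induction k arbitrary: f g)
  case (Suc k)
  show ?case
    using Suc.prems
    by (intro Ck_SucI[OF has_derivative_add[OF Ck_Suc_has_derivative Ck_Suc_has_derivative]] Suc.IH)
       auto
qed (simp add: continuous_on_add)

lemma Ck_bounded_linear_compose:
  assumes "bounded_linear L"
  shows "Ck k f \<Longrightarrow> Ck k (\<lambda>x. L (f x))"
proof (induction k arbitrary: f)
  case 0
  then show ?case using bounded_linear.continuous_on[OF assms] by auto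
next
  case (Suc k)
  show ?case
    using Suc.prems
    by (intro Ck_SucI[OF bounded_linear.has_derivative[OF assms Ck_Suc_has_derivative]] Suc.IH) auto
qed

lemma Ck_mult:
  fixes f g :: "'a::euclidean_space \<Rightarrow> real"
  shows "Ck k f \<Longrightarrow> Ck k g \<Longrightarrow> Ck k (\<lambda>x. f x * g x)"
proof (induction k arbitrary: f g)
  case (Suc k)
  show ?case
    using Suc.prems Ck_SucD[OF Suc.prems(1)] Ck_SucD[OF Suc.prems(2)]
    by (intro Ck_SucI[OF has_derivative_mult[OF Ck_Suc_has_derivative Ck_Suc_has_derivative]]
        Ck_add Suc.IH) auto
qed (simp add: continuous_on_mult)

lemma Ck_bounded_linear:
  assumes "bounded_linear L"
  shows "Ck k L"
proof (cases k)
  case 0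
  then show ?thesis using linear_continuous_on[OF assms] by auto
next
  case (Suc m)
  then show ?thesis
    using bounded_linear_imp_has_derivative[OF assms]
    by (auto intro: Ck_SucI[where f' = "\<lambda>x v. L v"] Ck_const simp del: Ck.simps)
qed

lemma Ck_exp:
  fixes f :: "'a::euclidean_space \<Rightarrow> real"
  shows "Ck k f \<Longrightarrow> Ck k (\<lambda>x. exp (f x))"
proof (induction k arbitrary: f)
  case (Suc k)
  have d: "((\<lambda>x. exp (f x)) has_derivative (\<lambda>v. exp (f x) * frechet_derivative f (at x) v)) (at x)" for x
    using has_derivative_exp[OF Ck_Suc_has_derivative[OF Suc.prems]] by (simp add: mult.commute)
  show ?case
    using Suc.prems Ck_SucD[OF Suc.prems] by (intro Ck_SucI[OF d] Ck_mult Suc.IH) auto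
qed (simp add: continuous_on_exp)

lemma has_derivative_gaussian:
  "((\<lambda>x::'a::euclidean_space. exp (c * (x \<bullet> x))) has_derivative
     (\<lambda>v. 2 * c * (x \<bullet> v) * exp (c * (x \<bullet> x)))) (at x)"
  by (auto intro!: derivative_eq_intros simp: fun_eq_iff inner_commute algebra_simps)

lemma Ck_gaussian: "Ck k (\<lambda>x::'a::euclidean_space. exp (c * (x \<bullet> x)))"
proof (rule Ck_exp)
  have "Ck (Suc k) (\<lambda>x::'a. c * (x \<bullet> x))"
  proof (rule Ck_SucI)
    show "((\<lambda>x::'a. c * (x \<bullet> x)) has_derivative (\<lambda>v. 2 * c * (x \<bullet> v))) (at x)" for x
      by (auto intro!: derivative_eq_intros simp: fun_eq_iff inner_commute algebra_simps)
    show "Ck k (\<lambda>x::'a. 2 * c * (x \<bullet> v))" for v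
      by (rule Ck_bounded_linear) (intro bounded_linear_intros)
  qed
  then show "Ck k (\<lambda>x::'a. c * (x \<bullet> x))" by (rule Ck_SucD)
qed

section \<open>Gradient and divergence\<close>

lemma grad_eqI:
  assumes "(u has_derivative (\<lambda>v. v \<bullet> D)) (at x)"
  shows "grad u x = D"
  unfolding grad_def gderiv_def
proof (rule the_equality)
  fix E assume "(u has_derivative (\<lambda>v. v \<bullet> E)) (at x)"
  then have "(\<lambda>v. v \<bullet> E) = (\<lambda>v. v \<bullet> D)" using assms by (rule has_derivative_unique)
  then have "\<forall>v. v \<bullet> E = v \<bullet> D" by (simp add: fun_eq_iff)
  then show "E = D" by (simp add: vector_eq_ldot)
qed (rule assms)

text \<open>
  By Riesz representation: the representing vector of a linear functional is its adjoint
  applied to \<open>1\<close>.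
\<close>

lemma grad_inner:
  assumes "u differentiable (at x)"
  shows "grad u x \<bullet> v = frechet_derivative u (at x) v"
proof -
  let ?L = "frechet_derivative u (at x)"
  have d: "(u has_derivative ?L) (at x)" using assms by (simp add: frechet_derivative_works)
  have "linear ?L" using d has_derivative_linear by blast
  then have L: "?L = (\<lambda>w. w \<bullet> adjoint ?L 1)"
    using adjoint_works[of ?L _ 1] by (auto simp: inner_commute)
  have "grad u x = adjoint ?L 1"
    by (rule grad_eqI) (subst L[symmetric], rule d)
  then show ?thesis using fun_cong[OF L, of v] by (simp only: inner_commute)
qed

text \<open>
  The derivative of \<open>f x *\<^sub>R a\<close> is the rank-one map \<open>v \<mapsto> f' v *\<^sub>R a\<close>, whose trace is
  \<open>f' a\<close>. Writing a field in a constant frame thus turns its divergence into directional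
  derivatives along the frame.
\<close>

lemma divergence_two_directions:
  assumes "(f has_derivative f') (at x)" and "(g has_derivative g') (at x)"
  shows "divergence (\<lambda>x. f x *\<^sub>R a + g x *\<^sub>R b) x = f' a + g' b"
proof -
  have "((\<lambda>x. f x *\<^sub>R a + g x *\<^sub>R b) has_derivative (\<lambda>v. f' v *\<^sub>R a + g' v *\<^sub>R b)) (at x)"
    using assms by (auto intro!: derivative_eq_intros)
  then have *: "frechet_derivative (\<lambda>x. f x *\<^sub>R a + g x *\<^sub>R b) (at x) = (\<lambda>v. f' v *\<^sub>R a + g' v *\<^sub>R b)"
    using frechet_derivative_at by metis
  have trace: "(\<Sum>e\<in>Basis. L e * (c \<bullet> e)) = L c" if "linear L" for L :: "'a \<Rightarrow> real" and c
  proof -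
    have "L c = L (\<Sum>e\<in>Basis. (c \<bullet> e) *\<^sub>R e)" by (simp add: euclidean_representation)
    also have "\<dots> = (\<Sum>e\<in>Basis. L e * (c \<bullet> e))"
      using that by (simp add: linear_sum linear_scale mult.commute)
    finally show ?thesis by simp
  qed
  show ?thesis
    unfolding divergence_def *
    using trace[OF has_derivative_linear[OF assms(1)], of a]
      trace[OF has_derivative_linear[OF assms(2)], of b]
    by (simp add: inner_add_left sum.distrib)
qed

section \<open>The conductivity in its eigenframe\<close>

text \<open>
  The frame is left unnormalised, with squared length 2, to keep square roots out of the formulas.
\<close>

definition diag :: "real^2" where "diag = dx + dy"

definition antidiag :: "real^2" where "antidiag = dx - dy"

lemma inner_diag: "v \<bullet> diag = v $ 1 + v $ 2"
  by (simp add: diag_def dx_def dy_def inner_add_right inner_axis)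

lemma inner_antidiag: "v \<bullet> antidiag = v $ 1 - v $ 2"
  by (simp add: antidiag_def dx_def dy_def inner_diff_right inner_axis)

lemma frame_inner [simp]:
  "diag \<bullet> diag = 2" "antidiag \<bullet> antidiag = 2" "diag \<bullet> antidiag = 0" "antidiag \<bullet> diag = 0"
  by (simp_all add: inner_diag inner_antidiag) (simp_all add: diag_def antidiag_def dx_def dy_def axis_def)

lemma norm_frame: "2 * (v \<bullet> v) = (v \<bullet> diag)\<^sup>2 + (v \<bullet> antidiag)\<^sup>2"
  unfolding inner_diag inner_antidiag
  by (simp add: inner_vec_def sum_2 power2_eq_square algebra_simps)

lemma W_field_frame:
  "W_field lam \<alpha> p v =
     (exp (\<alpha> * (p \<bullet> p)) * (lam * (v \<bullet> diag))) *\<^sub>R diag +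
     (exp (\<alpha> * (p \<bullet> p)) * (v \<bullet> antidiag)) *\<^sub>R antidiag"
  unfolding W_field_def inner_diag inner_antidiag
  by (simp add: vec_eq_iff forall_2 diag_def antidiag_def dx_def dy_def axis_def
      inner_vec_def sum_2 power2_eq_square algebra_simps)

lemma conductivity_W_field:
  assumes "lam > 0"
  shows "conductivity (W_field lam \<alpha>)"
  unfolding conductivity_def
proof (intro conjI allI impI)
  show "linear (W_field lam \<alpha> x)" for x
    by (rule linearI) (simp_all add: W_field_frame inner_add_left algebra_simps)
  show "smooth (\<lambda>x. W_field lam \<alpha> x v)" for v
    unfolding smooth_def W_field_frame
    by (intro allI Ck_add Ck_bounded_linear_compose[OF bounded_linear_scaleR_left] Ck_mult
        Ck_gaussian Ck_const)
  show "W_field lam \<alpha> x v \<bullet> w = v \<bullet> W_field lam \<alpha> x w" for x v w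
    by (simp add: W_field_frame inner_add_left inner_add_right inner_commute algebra_simps)
  fix x v :: "real^2" assume "v \<noteq> 0"
  then have "(v \<bullet> diag)\<^sup>2 + (v \<bullet> antidiag)\<^sup>2 > 0"
    using norm_frame[of v] inner_gt_zero_iff[of v] by linarith
  then have "lam * (v \<bullet> diag)\<^sup>2 + (v \<bullet> antidiag)\<^sup>2 > 0"
    using assms by (metis add_nonneg_pos add_pos_nonneg add_0 less_eq_real_def mult_pos_pos
        mult_zero_right zero_le_power2)
  then have "exp (\<alpha> * (x \<bullet> x)) * (lam * (v \<bullet> diag)\<^sup>2 + (v \<bullet> antidiag)\<^sup>2) > 0" by simp
  then show "W_field lam \<alpha> x v \<bullet> v > 0"
    by (simp add: W_field_frame inner_add_left inner_commute power2_eq_square algebra_simps)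
qed

text \<open>
  The flux is a combination of the two frame vectors, so only the pure second derivatives along them
  survive. This is what allows the second derivative test on lines to replace an argument about the
  full Hessian.
\<close>

lemma W_laplacian_frame:
  assumes "smooth u"
  defines "D \<equiv> \<lambda>v x. frechet_derivative u (at x) v"
  shows "W_laplacian (W_field lam \<alpha>) u p =
    exp (\<alpha> * (p \<bullet> p)) *
      (lam * (frechet_derivative (D diag) (at p) diag + 2 * \<alpha> * (p \<bullet> diag) * D diag p) +
       (frechet_derivative (D antidiag) (at p) antidiag + 2 * \<alpha> * (p \<bullet> antidiag) * D antidiag p))"
proof -
  have Ck: "Ck (Suc (Suc 0)) u" using assms unfolding smooth_def by blast
  have DD: "(D v has_derivative frechet_derivative (D v) (at p)) (at p)" for v
    using Ck by (simp add: D_def frechet_derivative_works)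
  have "grad u x \<bullet> v = D v x" for x v
    unfolding D_def using Ck by (intro grad_inner) auto
  then have "W_laplacian (W_field lam \<alpha>) u p =
      divergence (\<lambda>x. (exp (\<alpha> * (x \<bullet> x)) * (lam * D diag x)) *\<^sub>R diag +
                       (exp (\<alpha> * (x \<bullet> x)) * D antidiag x) *\<^sub>R antidiag) p"
    by (simp add: W_laplacian_def W_field_frame)
  also have "\<dots> = (exp (\<alpha> * (p \<bullet> p)) * (lam * frechet_derivative (D diag) (at p) diag) +
        2 * \<alpha> * (p \<bullet> diag) * exp (\<alpha> * (p \<bullet> p)) * (lam * D diag p)) +
      (exp (\<alpha> * (p \<bullet> p)) * frechet_derivative (D antidiag) (at p) antidiag +
        2 * \<alpha> * (p \<bullet> antidiag) * exp (\<alpha> * (p \<bullet> p)) * D antidiag p)"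
    by (rule divergence_two_directions)
       (intro has_derivative_mult has_derivative_mult_right has_derivative_gaussian DD)+
  finally show ?thesis by (simp add: algebra_simps)
qed

section \<open>Hyperbolicity\<close>

text \<open>
  The function \<open>u\<close> below solves \<open>W (grad u) = 2 * \<alpha> * A p\<close>; its Laplacian is
  the constant \<open>4 * \<alpha> * (lam + 1)\<close>.
\<close>

lemma W_hyperbolic_pos:
  assumes "lam > 0" "\<alpha> > 0"
  shows "W_hyperbolic (W_field lam \<alpha>)"
proof -
  define u :: "real^2 \<Rightarrow> real" where "u = (\<lambda>x. - exp (- \<alpha> * (x \<bullet> x)))"
  have "smooth u"
    unfolding smooth_def u_def
    by (intro allI Ck_bounded_linear_compose[OF bounded_linear_minus[OF bounded_linear_ident]]
        Ck_gaussian)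
  have grad: "grad u x = (2 * \<alpha> * exp (- \<alpha> * (x \<bullet> x))) *\<^sub>R x" for x
    unfolding u_def
    by (rule grad_eqI) (use has_derivative_minus[OF has_derivative_gaussian[of "- \<alpha>" x]]
        in \<open>simp add: inner_commute algebra_simps\<close>)
  have field: "W_field lam \<alpha> x (grad u x) =
      (2 * \<alpha> * lam * (x \<bullet> diag)) *\<^sub>R diag + (2 * \<alpha> * (x \<bullet> antidiag)) *\<^sub>R antidiag" for x
    unfolding W_field_frame grad by (simp add: exp_minus field_simps)
  have "W_laplacian (W_field lam \<alpha>) u x =
      2 * \<alpha> * lam * (diag \<bullet> diag) + 2 * \<alpha> * (antidiag \<bullet> antidiag)" for x
    unfolding W_laplacian_def field
    by (rule divergence_two_directions) (auto intro!: derivative_eq_intros)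
  then have "W_subharmonic (W_field lam \<alpha>) u"
    using \<open>smooth u\<close> assms unfolding W_subharmonic_def by auto
  moreover have "bdd_above (range u)"
    by (rule bdd_aboveI2[of _ _ 0]) (simp add: u_def)
  moreover have "\<not> u constant_on UNIV"
  proof
    assume "u constant_on UNIV"
    then have "u 0 = u diag" unfolding constant_on_def by auto
    then show False using assms by (simp add: u_def)
  qed
  ultimately show ?thesis unfolding W_hyperbolic_def W_parabolic_def by blast
qed

section \<open>Parabolicity\<close>

text \<open>
  If \<open>D > 0\<close>, then \<open>\<phi>'\<close> is positive just to the right of its zero, and \<open>\<phi>\<close>
  rises there.
\<close>

lemma second_derivative_test_max:
  fixes \<phi> \<phi>' :: "real \<Rightarrow> real"
  assumes d: "\<forall>\<^sub>F t in nhds 0. (\<phi> has_real_derivative \<phi>' t) (at t)"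
    and d2: "(\<phi>' has_real_derivative D) (at 0)"
    and mx: "\<forall>\<^sub>F t in nhds 0. \<phi> t \<le> \<phi> 0"
  shows "\<phi>' 0 = 0" and "D \<le> 0"
proof -
  obtain r where r: "r > 0" "\<And>t. \<bar>t\<bar> < r \<Longrightarrow> (\<phi> has_real_derivative \<phi>' t) (at t) \<and> \<phi> t \<le> \<phi> 0"
    using eventually_conj[OF d mx] unfolding eventually_nhds_metric dist_real_def by auto
  show z: "\<phi>' 0 = 0"
    by (rule DERIV_local_max[of \<phi> _ 0 r]) (use r in auto)
  show "D \<le> 0"
  proof (rule ccontr)
    assume "\<not> D \<le> 0"
    then obtain q where q: "q > 0" "\<And>h. 0 < h \<Longrightarrow> h < q \<Longrightarrow> \<phi>' 0 < \<phi>' h"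
      using DERIV_pos_inc_right[OF d2] by auto
    define h where "h = min r q / 2"
    have h: "0 < h" "h < r" "h < q" using r(1) q(1) unfolding h_def by (simp_all add: min_def)
    obtain t where t: "0 < t" "t < h" "\<phi> h - \<phi> 0 = (h - 0) * \<phi>' t"
      using MVT2[of 0 h \<phi> \<phi>'] h r(2) by auto
    have "\<phi>' t > 0" using q(2)[of t] t h z by auto
    then have "\<phi> h > \<phi> 0" using t h by (simp add: algebra_simps) 
    then show False using r(2)[of h] h by auto
  qed
qed

text \<open>
  The topological half of the comparison argument. On the small set \<open>s \<le> \<delta>\<close> around \<open>p0\<close>
  the function \<open>u\<close> stays below \<open>u p1\<close> by a fixed margin \<open>\<eta>\<close>, and \<open>\<epsilon>\<close>
  is chosen so small that subtracting \<open>\<epsilon> * f (s p)\<close> does not use up that margin between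
  \<open>p1\<close> and the boundary \<open>s = \<delta>\<close>. For large \<open>s\<close> the divergence of \<open>f\<close> beats the
  bound on \<open>u\<close>. Hence the maximum over the compact shell \<open>\<delta> \<le> s \<le> T\<close> is attained in its
  interior. The profile \<open>f\<close> may be singular at 0.
\<close>

lemma exterior_comparison:
  fixes u s :: "'a::euclidean_space \<Rightarrow> real" and f :: "real \<Rightarrow> real"
  assumes cu: "continuous_on UNIV u" and bu: "bdd_above (range u)" and lt: "u p0 < u p1"
    and cs: "continuous_on UNIV s" and C: "C > 0" "\<And>p. (norm (p - p0))\<^sup>2 \<le> C * s p"
    and cf: "continuous_on {0<..} f" and lim: "filterlim f at_top at_top"
  obtains \<epsilon> p where "\<epsilon> > 0" "s p > 0"
    "\<forall>\<^sub>F q in nhds p. u q - \<epsilon> * f (s q) \<le> u p - \<epsilon> * f (s p)"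
proof -
  define \<eta> where "\<eta> = (u p1 - u p0) / 2"
  have \<eta>: "\<eta> > 0" "u p0 < u p1 - \<eta>" using lt by (simp_all add: \<eta>_def field_simps)
  have "open {p. u p < u p1 - \<eta>}" using cu by (intro open_Collect_less continuous_intros)
  then obtain r where r: "r > 0" "\<And>p. dist p p0 < r \<Longrightarrow> u p < u p1 - \<eta>"
    using \<eta>(2) unfolding open_dist by blast
  define \<delta> where "\<delta> = r\<^sup>2 / (2 * C)"
  have \<delta>: "\<delta> > 0" using r C by (simp add: \<delta>_def)
  have small: "u p < u p1 - \<eta>" if "s p \<le> \<delta>" for p
  proof -
    have "(norm (p - p0))\<^sup>2 \<le> C * \<delta>" using C that by (meson mult_left_mono less_imp_le order_trans)
    also have "\<dots> < r\<^sup>2" using C r by (simp add: \<delta>_def)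
    finally show ?thesis using r by (intro r(2)) (simp add: dist_norm power2_less_imp_less)
  qed
  have s1: "s p1 > \<delta>" using small[of p1] \<eta> by force
  define \<epsilon> where "\<epsilon> = \<eta> / (\<bar>f (s p1) - f \<delta>\<bar> + 1)"
  have \<epsilon>: "\<epsilon> > 0" using \<eta> by (simp add: \<epsilon>_def)
  have "\<epsilon> * (f (s p1) - f \<delta>) \<le> \<epsilon> * \<bar>f (s p1) - f \<delta>\<bar>" using \<epsilon> by simp
  also have "\<dots> < \<epsilon> * (\<bar>f (s p1) - f \<delta>\<bar> + 1)" using \<epsilon> by simp
  also have "\<dots> = \<eta>" unfolding \<epsilon>_def by simp
  finally have \<epsilon>\<eta>: "\<epsilon> * (f (s p1) - f \<delta>) < \<eta>" .
  define v where "v = (\<lambda>p. u p - \<epsilon> * f (s p))"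
  obtain B where B: "\<And>p. u p \<le> B" using bu unfolding bdd_above_def by auto
  obtain T where T: "\<And>t. t \<ge> T \<Longrightarrow> f t > (B - v p1) / \<epsilon>"
    using lim unfolding filterlim_at_top_dense eventually_at_top_linorder by blast
  have far: "v p < v p1" if "s p \<ge> T" for p
    using T[OF that] B[of p] \<epsilon> by (simp add: v_def field_simps)
  have near: "v p < v p1" if "s p = \<delta>" for p
    using small[of p] that \<epsilon>\<eta> by (simp add: v_def algebra_simps)
  define K where "K = s -` {\<delta>..T}"
  have "closed K" unfolding K_def by (intro closed_vimage cs closed_atLeastAtMost)
  moreover have "K \<subseteq> cball p0 (sqrt (C * T))"
  proof
    fix p assume "p \<in> K"
    then have "C * s p \<le> C * T" using C by (simp add: K_def)
    then have "(norm (p - p0))\<^sup>2 \<le> C * T" using C(2)[of p] by linarith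
    then show "p \<in> cball p0 (sqrt (C * T))" by (simp add: dist_norm norm_minus_commute real_le_rsqrt)
  qed
  then have "bounded K" using bounded_subset bounded_cball by blast
  ultimately have "compact K" by (simp add: compact_eq_bounded_closed)
  moreover have p1K: "p1 \<in> K" using s1 far[of p1] by (force simp: K_def)
  moreover have "continuous_on K v"
    unfolding v_def
    by (intro continuous_intros continuous_on_subset[OF cu] continuous_on_compose2[OF cf]
        continuous_on_subset[OF cs]) (use \<delta> in \<open>auto simp: K_def\<close>)
  ultimately obtain p where p: "p \<in> K" "\<And>q. q \<in> K \<Longrightarrow> v q \<le> v p"
    using continuous_attains_sup[of K v] by blast
  have "v p1 \<le> v p" using p p1K by blast
  then have sp: "\<delta> < s p" "s p < T" using far[of p] near[of p] p(1) by (force simp: K_def)+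
  have "open (s -` {\<delta><..<T})" by (intro open_vimage cs open_greaterThanLessThan)
  then have "\<forall>\<^sub>F q in nhds p. q \<in> s -` {\<delta><..<T}" using sp by (intro eventually_nhds_in_open) auto
  then have "\<forall>\<^sub>F q in nhds p. v q \<le> v p"
    by eventually_elim (intro p(2), auto simp: K_def)
  then show thesis using that[of \<epsilon> p] \<epsilon> \<delta> sp unfolding v_def by simp
qed

text \<open>
  The second derivative test for \<open>u - \<epsilon> * f \<circ> s\<close> on a line through the
  maximum point, on which \<open>s\<close> is a quadratic polynomial. The right-hand sides are
  \<open>\<epsilon>\<close> times the first and second derivative of \<open>f \<circ> s\<close> along that line.
\<close>

lemma line_test:
  fixes u :: "'a::euclidean_space \<Rightarrow> real" and f f1 s :: _
  assumes u: "smooth u" and sp: "s p > 0"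
    and f: "\<And>t. t > 0 \<Longrightarrow> (f has_real_derivative f1 t) (at t)"
    and f1: "(f1 has_real_derivative f2) (at (s p))"
    and s: "\<And>t. s (p + t *\<^sub>R a) = s p + s1 * t + s2 * t\<^sup>2"
    and mx: "\<forall>\<^sub>F q in nhds p. u q - \<epsilon> * f (s q) \<le> u p - \<epsilon> * f (s p)"
  defines "D \<equiv> \<lambda>x. frechet_derivative u (at x) a"
  shows "D p = \<epsilon> * (f1 (s p) * s1)"
    and "frechet_derivative D (at p) a \<le> \<epsilon> * (f2 * s1\<^sup>2 + f1 (s p) * (2 * s2))"
proof -
  have Ck: "Ck (Suc (Suc 0)) u" using u unfolding smooth_def by blast
  define l where "l = (\<lambda>t. p + t *\<^sub>R a)"
  define \<sigma> where "\<sigma> = (\<lambda>t. s p + s1 * t + s2 * t\<^sup>2)"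
  have line: "((\<lambda>t. g (l t)) has_real_derivative g' a) (at t)"
    if g: "(g has_derivative g') (at (l t))" for g :: "'a \<Rightarrow> real" and g' t
  proof -
    have "(l has_derivative (\<lambda>h. h *\<^sub>R a)) (at t)"
      unfolding l_def by (auto intro!: derivative_eq_intros)
    from has_derivative_compose[OF this g]
    have "((\<lambda>t. g (l t)) has_derivative (\<lambda>h. g' (h *\<^sub>R a))) (at t)" .
    moreover have "(\<lambda>h. g' (h *\<^sub>R a)) = (*) (g' a)"
      using has_derivative_linear[OF g] by (auto simp: linear_scale)
    ultimately show ?thesis by (simp add: has_field_derivative_def)
  qed
  have ul: "((\<lambda>t. u (l t)) has_real_derivative D (l t)) (at t)" for t
    unfolding D_def by (rule line) (use Ck in \<open>simp add: frechet_derivative_works\<close>)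
  have Dl: "((\<lambda>t. D (l t)) has_real_derivative frechet_derivative D (at p) a) (at 0)"
  proof -
    have "(D has_derivative frechet_derivative D (at p)) (at (l 0))"
      using Ck by (simp add: D_def frechet_derivative_works l_def)
    then show ?thesis by (rule line)
  qed
  have \<sigma>: "(\<sigma> has_real_derivative s1 + 2 * s2 * t) (at t)" for t
    unfolding \<sigma>_def by (auto intro!: derivative_eq_intros)
  have \<sigma>0: "\<sigma> 0 = s p" by (simp add: \<sigma>_def)
  have "isCont \<sigma> 0" using \<sigma> DERIV_isCont by blast
  then have "\<forall>\<^sub>F t in nhds 0. \<sigma> t > 0"
    unfolding isCont_def tendsto_at_iff_tendsto_nhds
    by (rule order_tendstoD(1)) (use sp \<sigma>0 in simp)
  then have e1: "\<forall>\<^sub>F t in nhds 0. ((\<lambda>t. u (l t) - \<epsilon> * f (\<sigma> t)) has_real_derivative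
      D (l t) - \<epsilon> * (f1 (\<sigma> t) * (s1 + 2 * s2 * t))) (at t)"
    by eventually_elim (intro DERIV_diff ul DERIV_cmult DERIV_chain2[OF f \<sigma>])
  have f1': "(f1 has_real_derivative f2) (at (\<sigma> 0))" using f1 \<sigma>0 by simp
  have e2: "((\<lambda>t. D (l t) - \<epsilon> * (f1 (\<sigma> t) * (s1 + 2 * s2 * t))) has_real_derivative
      frechet_derivative D (at p) a - \<epsilon> * (f2 * s1\<^sup>2 + f1 (s p) * (2 * s2))) (at 0)"
    by (rule derivative_eq_intros Dl DERIV_chain2[OF f1' \<sigma>] refl)+
       (simp add: \<sigma>0 power2_eq_square)
  have "(l \<longlongrightarrow> p) (nhds 0)"
    unfolding l_def by (auto intro!: tendsto_eq_intros filterlim_ident)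
  then have "\<forall>\<^sub>F t in nhds 0. u (l t) - \<epsilon> * f (s (l t)) \<le> u p - \<epsilon> * f (s p)"
    by (rule eventually_compose_filterlim[OF mx])
  then have e3: "\<forall>\<^sub>F t in nhds 0. u (l t) - \<epsilon> * f (\<sigma> t) \<le> u (l 0) - \<epsilon> * f (\<sigma> 0)"
    by (simp add: l_def s \<sigma>_def)
  show "D p = \<epsilon> * (f1 (s p) * s1)"
    using second_derivative_test_max(1)[OF e1 e2 e3] by (simp add: l_def \<sigma>0)
  show "frechet_derivative D (at p) a \<le> \<epsilon> * (f2 * s1\<^sup>2 + f1 (s p) * (2 * s2))"
    using second_derivative_test_max(2)[OF e1 e2 e3] by simp
qed

text \<open>
  The second derivative is written so as to display
  \<open>t * f'' + f' = - k\<^sup>2 * S ^ k / t ^ (k + 1)\<close>, which is up to a positive factor what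
  \<open>tr (A D\<^sup>2)\<close> makes of \<open>f \<circ> s\<close>: the logarithm contributes nothing, and the
  power contributes strict negativity.
\<close>

lemma barrier_profile:
  fixes S :: real and f f1 :: "real \<Rightarrow> real"
  assumes "S > 0" "k > 0"
    and f_def: "f = (\<lambda>t. ln t - S ^ k / t ^ k)"
    and f1_def: "f1 = (\<lambda>t. 1 / t + real k * S ^ k / t ^ Suc k)"
  shows "\<And>t. t > 0 \<Longrightarrow> (f has_real_derivative f1 t) (at t)"
    and "\<And>t. t > 0 \<Longrightarrow>
      (f1 has_real_derivative - (f1 t + (real k)\<^sup>2 * S ^ k / t ^ Suc k) / t) (at t)"
    and "filterlim f at_top at_top"
proof -
  fix t :: real assume t: "t > 0"
  have pow: "t * t ^ (k - Suc 0) = t ^ k"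
    using power_minus_mult[OF assms(2), of t] by (simp add: mult.commute)
  show "(f has_real_derivative f1 t) (at t)"
    unfolding f_def f1_def using t pow
    by (auto intro!: derivative_eq_intros simp: field_simps power2_eq_square)
  show "(f1 has_real_derivative - (f1 t + (real k)\<^sup>2 * S ^ k / t ^ Suc k) / t) (at t)"
    unfolding f1_def using t
    by (auto intro!: derivative_eq_intros simp: pow field_simps power2_eq_square)
next
  have "((\<lambda>t. S ^ k / t ^ k) \<longlongrightarrow> 0) at_top"
    using assms(2) by (intro tendsto_divide_0[OF tendsto_const] filterlim_at_top_imp_at_infinity
        filterlim_pow_at_top filterlim_ident)
  from filterlim_tendsto_add_at_top[OF tendsto_minus[OF this] ln_at_top]
  show "filterlim f at_top at_top" unfolding f_def by simp
qed

text \<open>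
  What remains is the sign of \<open>L h\<close> for \<open>h = f \<circ> s\<close>. At the maximum point it is a positive multiple of
  \<open>\<alpha> * Z * F - 2 * k\<^sup>2 * y\<close>, where \<open>F = s * f'(s) = 1 + k * y\<close>,
  \<open>y = (S / s) ^ k\<close>, and \<open>Z = 2 * (p \<bullet> (p - p0))\<close>, so that \<open>\<alpha> * Z\<close> has the sign of
  the derivative of \<open>s\<close> along the drift. This is negative if \<open>Z \<ge> 0\<close>. The set \<open>Z < 0\<close> is an open disc having the segment
  from the origin to \<open>p0\<close> as a diameter; there \<open>s \<le> S\<close>, so
  \<open>y \<ge> 1\<close> and the quadratic growth in \<open>k\<close> wins.
\<close>

lemma W_parabolic_nonpos:
  assumes lam: "lam > 0" and "\<alpha> \<le> 0"
  shows "W_parabolic (W_field lam \<alpha>)"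
  unfolding W_parabolic_def
proof (intro allI impI)
  fix u :: "real^2 \<Rightarrow> real"
  assume sub: "W_subharmonic (W_field lam \<alpha>) u" and bdd: "bdd_above (range u)"
  have u: "smooth u" and Lu: "\<And>p. W_laplacian (W_field lam \<alpha>) u p \<ge> 0"
    using sub unfolding W_subharmonic_def by auto
  have cu: "continuous_on UNIV u" using u unfolding smooth_def by (metis Ck.simps(1))
  have "u p1 \<le> u p0" for p0 p1
  proof (rule ccontr)
    assume "\<not> u p1 \<le> u p0"
    then have lt: "u p0 < u p1" by simp
    define X where "X = (\<lambda>p. (p - p0) \<bullet> diag)"
    define Y where "Y = (\<lambda>p. (p - p0) \<bullet> antidiag)"
    define s where "s = (\<lambda>p. (X p)\<^sup>2 / lam + (Y p)\<^sup>2)"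
    define R where "R = (p0 \<bullet> diag)\<^sup>2 + (p0 \<bullet> antidiag)\<^sup>2"
    \<comment> \<open>\<open>S\<close> bounds \<open>s\<close> wherever the drift increases it; the summand 1 keeps it
      positive when \<open>p0 = 0\<close>.\<close>
    define S where "S = (1 / lam + 1) * (R + 1)"
    \<comment> \<open>Just large enough for \<open>\<alpha> * Z \<le> k - 1\<close> where \<open>Z < 0\<close>.\<close>
    define k where "k = nat \<lceil>- \<alpha> * R\<rceil> + 1"
    have R: "R \<ge> 0" by (simp add: R_def)
    have S: "S > 0" using R lam by (simp add: S_def add_pos_pos)
    have k: "k > 0" "real k \<ge> - \<alpha> * R + 1" unfolding k_def by (auto simp: of_nat_nat) linarith
    define f where "f = (\<lambda>t. ln t - S ^ k / t ^ k)"
    define f1 where "f1 = (\<lambda>t. 1 / t + real k * S ^ k / t ^ Suc k)"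
    note profile = barrier_profile[OF S k(1) f_def f1_def]
    have cf: "continuous_on {0<..} f"
      by (rule DERIV_continuous_on) (auto intro: has_field_derivative_at_within profile(1))
    have cs: "continuous_on UNIV s" unfolding s_def X_def Y_def by (intro continuous_intros) (use lam in auto)
    have norm_s: "(norm (p - p0))\<^sup>2 \<le> (lam + 1) * s p" for p
    proof -
      have "2 * (norm (p - p0))\<^sup>2 = (X p)\<^sup>2 + (Y p)\<^sup>2"
        using norm_frame[of "p - p0"] by (simp add: X_def Y_def power2_norm_eq_inner)
      moreover have "(lam + 1) * s p = (X p)\<^sup>2 + (Y p)\<^sup>2 + ((X p)\<^sup>2 / lam + lam * (Y p)\<^sup>2)"
        using lam by (simp add: s_def field_simps)
      moreover have "(X p)\<^sup>2 / lam + lam * (Y p)\<^sup>2 \<ge> 0" using lam by simp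
      ultimately show ?thesis by (smt (verit) zero_le_power2)
    qed
    obtain \<epsilon> p where \<epsilon>: "\<epsilon> > 0" and sp: "s p > 0"
      and mx: "\<forall>\<^sub>F q in nhds p. u q - \<epsilon> * f (s q) \<le> u p - \<epsilon> * f (s p)"
      using exterior_comparison[OF cu bdd lt cs _ norm_s cf profile(3)] lam by auto
    define y where "y = S ^ k / s p ^ k"
    define f2 where "f2 = - (f1 (s p) + (real k)\<^sup>2 * S ^ k / s p ^ Suc k) / s p"
    have sa: "s (p + t *\<^sub>R diag) = s p + (4 * X p / lam) * t + (4 / lam) * t\<^sup>2" for t
      using lam by (simp add: s_def X_def Y_def inner_diff_left inner_add_left power2_eq_square field_simps)
    have sb: "s (p + t *\<^sub>R antidiag) = s p + (4 * Y p) * t + 4 * t\<^sup>2" for t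
      using lam by (simp add: s_def X_def Y_def inner_diff_left inner_add_left power2_eq_square field_simps)
    note A = line_test[OF u sp profile(1) profile(2)[OF sp] sa mx, folded f2_def]
    note B = line_test[OF u sp profile(1) profile(2)[OF sp] sb mx, folded f2_def]
    have DA: "frechet_derivative u (at p) diag = \<epsilon> * (f1 (s p) * (4 * X p / lam))"
      using A(1) by simp
    have DB: "frechet_derivative u (at p) antidiag = \<epsilon> * (f1 (s p) * (4 * Y p))"
      using B(1) by simp
    define Z where "Z = (p \<bullet> diag) * X p + (p \<bullet> antidiag) * Y p"
    define F where "F = 1 + real k * y"
    have f1: "f1 (s p) = F / s p" using sp by (simp add: f1_def F_def y_def field_simps)
    have f2: "f2 * s p = - (F + (real k)\<^sup>2 * y) / s p"
      using sp by (simp add: f2_def f1 y_def field_simps)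
    have "0 \<le> exp (\<alpha> * (p \<bullet> p)) * (lam * (frechet_derivative (\<lambda>x. frechet_derivative u (at x) diag) (at p) diag
        + 2 * \<alpha> * (p \<bullet> diag) * frechet_derivative u (at p) diag) +
       (frechet_derivative (\<lambda>x. frechet_derivative u (at x) antidiag) (at p) antidiag
        + 2 * \<alpha> * (p \<bullet> antidiag) * frechet_derivative u (at p) antidiag))"
      using Lu[of p] unfolding W_laplacian_frame[OF u] .
    then have "0 \<le> lam * (frechet_derivative (\<lambda>x. frechet_derivative u (at x) diag) (at p) diag
        + 2 * \<alpha> * (p \<bullet> diag) * frechet_derivative u (at p) diag) +
       (frechet_derivative (\<lambda>x. frechet_derivative u (at x) antidiag) (at p) antidiag
        + 2 * \<alpha> * (p \<bullet> antidiag) * frechet_derivative u (at p) antidiag)"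
      by (simp add: zero_le_mult_iff)
    also have "\<dots> \<le> lam * (\<epsilon> * (f2 * (4 * X p / lam)\<^sup>2 + f1 (s p) * (2 * (4 / lam)))
        + 2 * \<alpha> * (p \<bullet> diag) * (\<epsilon> * (f1 (s p) * (4 * X p / lam)))) +
       (\<epsilon> * (f2 * (4 * Y p)\<^sup>2 + f1 (s p) * (2 * 4))
        + 2 * \<alpha> * (p \<bullet> antidiag) * (\<epsilon> * (f1 (s p) * (4 * Y p))))"
      unfolding DA DB using lam by (intro A(2) B(2) order_refl add_mono mult_left_mono less_imp_le)
    also have "\<dots> = 16 * \<epsilon> * (f2 * s p + f1 (s p)) + 8 * \<epsilon> * \<alpha> * f1 (s p) * Z"
      using lam by (simp add: s_def Z_def field_simps power2_eq_square)
    also have "\<dots> = (8 * \<epsilon> / s p) * (\<alpha> * Z * F - 2 * (real k)\<^sup>2 * y)"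
      unfolding f2 f1 using sp by (simp add: field_simps)
    finally have key: "\<alpha> * Z * F \<ge> 2 * (real k)\<^sup>2 * y"
      using \<epsilon> sp by (simp add: zero_le_mult_iff zero_le_divide_iff)
    have y: "y > 0" using S sp by (simp add: y_def)
    have F: "F > 0" using y by (simp add: F_def add_pos_nonneg)
    have ky: "(real k)\<^sup>2 * y > 0" using k y by simp
    then have "\<alpha> * Z * F > 0" using key by linarith
    then have "Z < 0" using F \<open>\<alpha> \<le> 0\<close> by (simp add: zero_less_mult_iff)
    \<comment> \<open>Completing the square confines the region \<open>Z < 0\<close>.\<close>
    have XY: "p \<bullet> diag = X p + p0 \<bullet> diag" "p \<bullet> antidiag = Y p + p0 \<bullet> antidiag"
      by (simp_all add: X_def Y_def inner_diff_left)
    have "R + 2 * Z - ((X p)\<^sup>2 + (Y p)\<^sup>2) = (p \<bullet> diag)\<^sup>2 + (p \<bullet> antidiag)\<^sup>2"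
      unfolding R_def Z_def XY by (simp add: power2_eq_square algebra_simps)
    then have XYR: "(X p)\<^sup>2 + (Y p)\<^sup>2 \<le> R + 2 * Z" by (smt (verit) zero_le_power2)
    then have ZR: "- Z \<le> R" using R by (smt (verit) zero_le_power2)
    have "s p \<le> (1 / lam + 1) * ((X p)\<^sup>2 + (Y p)\<^sup>2)"
      using lam by (simp add: s_def field_simps)
    also have "\<dots> \<le> S" unfolding S_def using XYR \<open>Z < 0\<close> lam by (intro mult_left_mono) auto
    finally have "s p \<le> S" .
    then have y1: "y \<ge> 1" using sp unfolding y_def by (simp add: power_mono)
    have "\<alpha> * Z \<le> - \<alpha> * R" using ZR \<open>\<alpha> \<le> 0\<close> mult_left_mono[of "- Z" R "- \<alpha>"] by simp
    also have "\<dots> \<le> real k - 1" using k by simp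
    finally have "\<alpha> * Z * F \<le> (real k - 1) * F" using F by (intro mult_right_mono) auto
    also have "\<dots> \<le> (real k - 1) * ((1 + real k) * y)"
      using y1 k by (intro mult_left_mono) (auto simp: F_def algebra_simps)
    also have "\<dots> < 2 * (real k)\<^sup>2 * y" using y ky by (simp add: power2_eq_square algebra_simps)
    finally show False using key by simp
  qed
  then show "u constant_on UNIV" unfolding constant_on_def by (metis antisym)
qed

theorem proposition2p2:
  fixes lam \<alpha> :: real
  assumes "lam > 0"
  shows "conductivity (W_field lam \<alpha>) \<and>
    (\<alpha> \<le> 0 \<longrightarrow> W_parabolic (W_field lam \<alpha>)) \<and>
    (\<alpha> > 0 \<longrightarrow> W_hyperbolic (W_field lam \<alpha>))"
  using conductivity_W_field W_parabolic_nonpos W_hyperbolic_pos assms by blast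

end
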